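(* Let $q$ be a prime power and let $C$ be an $[n,k]_q$ code of full length, $k\ge1$. Let $\lambda\ge\gamma(\mathcal{M}_C)$ be an integer, and suppose that $\mathcal{M}_C^{[\lambda]}$ is spanning. Then $n(C^{[\lambda]})=\lambda{k\brack 1}_q-n$. Moreover, for every $1\le r\le k$ and every integer $j$, $$B_j^{(r)}(C^{[\lambda]})=B^{(r)}_{\lambda q^{k-r}{r\brack 1}_q-j}(C).$$ In particular, $$d_r(C^{[\lambda]})=\lambda q^{k-r}{r\brack 1}_q-\delta_r(C),\qquad \delta_r(C^{[\lambda]})=\lambda q^{k-r}{r\brack 1}_q-d_r(C).$$
   Context: An $[n,k]_q$ code is a $k$-dimensional linear subspace $C\le\mathbb{F}_q^n$. For a subcode $A\le C$, $\mathrm{supp}(A)$ is the set of coordinates $j$ such that $a_j\neq 0$ for some $a\in A$, and $w(A)=|\mathrm{supp}(A)|$. The effective length is $n(C)=w(C)$; $C$ has full length if $n(C)=n$. For $1\le r\le k$, $d_r(C)$ and $\delta_r(C)$ are respectively the minimum and the maximum of $w(A)$ over all $r$-dimensional subcodes $A\le C$, and for an integer $j$, $B_j^{(r)}(C)=\#\{A\le C:\dim A=r,\ w(A)=j\}$. Put ${r\brack 1}_q=(q^r-1)/(q-1)$. Let $\mathcal{P}$ be the point set of $\mathrm{PG}(k-1,q)$, i.e. the set of one-dimensional subspaces of $\mathbb{F}_q^k$. A multiset of points is a map $\mathcal{M}:\mathcal{P}\to\mathbb{Z}_{\ge0}$; it is spanning if its points of positive multiplicity span $\mathrm{PG}(k-1,q)$,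 and $\gamma(\mathcal{M})=\max_{P\in\mathcal{P}}\mathcal{M}(P)$. If $G$ is a $k\times n$ generator matrix of a full-length code $C$ with columns $G_1,\dots,G_n$, then $\mathcal{M}_C(P)=\#\{j:\langle G_j\rangle=P\}$. Conversely every spanning multiset $\mathcal{M}$ is $\mathcal M_D$ for a full-length code $D$ (generated by a matrix whose columns contain, for each point $P$, exactly $\mathcal{M}(P)$ nonzero representatives of $P$), unique up to permuting coordinates and multiplying coordinates by nonzero scalars. For an integer $\lambda\ge\gamma(\mathcal{M}_C)$, the complement is the multiset $\mathcal{M}_C^{[\lambda]}(P)=\lambda-\mathcal{M}_C(P)$ for all $P\in\mathcal{P}$; when it is spanning, $C^{[\lambda]}$ denotes its associated code. *)

theory Defs
  imports "HOL-Analysis.Analysis"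
begin

text \<open>
  The field with q elements is a type of sort \<open>{field, finite}\<close> with \<open>CARD('a) = q\<close>, and an
  $[n,k]_q$ code is a subspace of \<open>'a ^ 'n\<close> with \<open>CARD('n) = n\<close>. The ambient space of
  $\mathrm{PG}(k-1,q)$ is \<open>'a ^ 'k\<close> with \<open>CARD('k) = k\<close>. Since index types are nonempty,
  $k \ge 1$ and $n \ge 1$ hold automatically.
\<close>

definition linear_code :: "nat \<Rightarrow> ('a::field ^ 'n) set \<Rightarrow> bool" where
  "linear_code k C \<longleftrightarrow> vec.subspace C \<and> vec.dim C = k"

definition supp :: "('a::zero ^ 'n) set \<Rightarrow> 'n set" where
  "supp A = {j. \<exists>a\<in>A. a $ j \<noteq> 0}"

definition weight :: "('a::zero ^ 'n) set \<Rightarrow> nat" where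
  "weight A = card (supp A)"

abbreviation effective_length :: "('a::zero ^ 'n) set \<Rightarrow> nat" where
  "effective_length C \<equiv> weight C"

definition full_length :: "('a::zero ^ 'n) set \<Rightarrow> bool" where
  "full_length (C :: ('a ^ 'n) set) \<longleftrightarrow> effective_length C = CARD('n)"

definition subcodes :: "nat \<Rightarrow> ('a::field ^ 'n) set \<Rightarrow> ('a ^ 'n) set set" where
  "subcodes r C = {A. A \<subseteq> C \<and> linear_code r A}"

definition min_weight :: "nat \<Rightarrow> ('a::field ^ 'n) set \<Rightarrow> nat" where
  "min_weight r C = Min (weight ` subcodes r C)"

definition max_weight :: "nat \<Rightarrow> ('a::field ^ 'n) set \<Rightarrow> nat" where
  "max_weight r C = Max (weight ` subcodes r C)"

definition weight_count :: "nat \<Rightarrow> int \<Rightarrow> ('a::field ^ 'n) set \<Rightarrow> nat" where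
  "weight_count r j C = card {A \<in> subcodes r C. int (weight A) = j}"

text \<open>The division is exact for $q \ge 2$.\<close>

definition gauss_number :: "nat \<Rightarrow> nat \<Rightarrow> nat" where
  "gauss_number q r = (q ^ r - 1) div (q - 1)"

definition proj_points :: "('a::field ^ 'k) set set" where
  "proj_points = {P. vec.subspace P \<and> vec.dim P = 1}"

text \<open>
  A multiset of points is a function on \<open>('a ^ 'k) set\<close>; only its values on \<open>proj_points\<close> are
  meaningful, and no definition below depends on the others.
\<close>

type_synonym ('a, 'k) point_multiset = "('a ^ 'k) set \<Rightarrow> nat"

definition spanning :: "('a::field, 'k::finite) point_multiset \<Rightarrow> bool" where
  "spanning M \<longleftrightarrow> vec.span (\<Union>{P \<in> proj_points. M P > 0}) = UNIV"

definition max_multiplicity :: "('a::field, 'k::finite) point_multiset \<Rightarrow> nat" where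
  "max_multiplicity M = Max (M ` proj_points)"

text \<open>
  The rows of \<open>G\<close> form a basis of \<open>C\<close>: there are \<open>CARD('k)\<close> of them, they span \<open>C\<close>, and \<open>C\<close> has
  dimension \<open>CARD('k)\<close>.
\<close>

definition generator_matrix :: "'a::field ^ 'n ^ 'k \<Rightarrow> ('a ^ 'n) set \<Rightarrow> bool" where
  "generator_matrix (G :: 'a ^ 'n ^ 'k) C \<longleftrightarrow> linear_code CARD('k) C \<and> vec.span (rows G) = C"

definition column_multiset :: "'a::field ^ 'n ^ 'k \<Rightarrow> ('a, 'k) point_multiset" where
  "column_multiset G P = card {j. vec.span {column j G} = P}"

text \<open>Used only for \<open>l \<ge> max_multiplicity M\<close>, where the subtraction does not truncate.\<close>

definition complement :: "nat \<Rightarrow> ('a::field, 'k::finite) point_multiset \<Rightarrow> ('a, 'k) point_multiset"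
  where "complement l M P = l - M P"

text \<open>
  The code associated with a multiset is determined only up to monomial equivalence, so it is
  rendered as a relation that holds for every full-length code realising the multiset. Lemma
  \<open>associated_code_exists\<close> below shows that every spanning multiset has such a code.
\<close>

definition associated_code :: "('a::field, 'k::finite) point_multiset \<Rightarrow> ('a ^ 'm) set \<Rightarrow> bool" where
  "associated_code M D \<longleftrightarrow> full_length D \<and>
     (\<exists>H :: 'a ^ 'm ^ 'k. generator_matrix H D \<and> (\<forall>P\<in>proj_points. column_multiset H P = M P))"

lemma proj_point_span:
  fixes P :: "('a::field ^ 'k) set"
  assumes "P \<in> proj_points"
  shows "\<exists>v. v \<noteq> 0 \<and> vec.span {v} = P"
proof -
  have P: "vec.subspace P" "vec.dim P = 1"
    using assms by (auto simp: proj_points_def)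
  obtain B where B: "B \<subseteq> P" "vec.independent B" "P \<subseteq> vec.span B" "card B = vec.dim P"
    using vec.basis_exists[of P] by blast
  then obtain v where v: "B = {v}"
    using P(2) by (metis card_1_singletonE)
  have "v \<noteq> 0"
    using B(2) v vec.dependent_zero by blast
  moreover have "vec.span {v} = P"
    using B v P(1) vec.span_minimal by blast
  ultimately show ?thesis by blast
qed

lemma dim_rows_if_columns_span:
  fixes H :: "'a::field ^ 'm ^ 'k"
  assumes "vec.span (columns H) = UNIV"
  shows "vec.dim (rows H) = CARD('k)"
proof -
  obtain B :: "'a ^ 'k ^ 'm" where "H ** B = mat 1"
    using assms matrix_right_invertible_span_columns by blast
  then have ind: "\<And>c. sum (\<lambda>i. c i *s row i H) UNIV = 0 \<Longrightarrow> (\<forall>i. c i = 0)"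
    using matrix_right_invertible_independent_rows by blast
  have rows: "rows H = range (\<lambda>i. row i H)"
    by (auto simp: rows_def)
  have inj: "inj (\<lambda>i. row i H)"
  proof (rule injI, rule ccontr)
    fix i j assume ij: "row i H = row j H" "i \<noteq> j"
    define c :: "'k \<Rightarrow> 'a" where "c l = (if l = i then 1 else if l = j then -1 else 0)" for l
    have "(\<Sum>l\<in>UNIV. c l *s row l H) = (\<Sum>l\<in>{i, j}. c l *s row l H)"
      by (rule sum.mono_neutral_right) (auto simp: c_def)
    also have "\<dots> = 0"
      using ij by (simp add: c_def)
    finally have "c i = 0" using ind by blast
    then show False by (simp add: c_def)
  qed
  have "vec.independent (rows H)"
  proof (rule vec.independent_if_scalars_zero)
    show "finite (rows H)" by (simp add: rows)
    fix f x assume f: "(\<Sum>x\<in>rows H. f x *s x) = 0" and "x \<in> rows H"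
    then obtain i where x: "x = row i H" by (auto simp: rows)
    have "(\<Sum>l\<in>UNIV. f (row l H) *s row l H) = 0"
      using f unfolding rows by (simp add: sum.reindex[OF inj])
    from ind[OF this] show "f x = 0" by (simp add: x)
  qed
  then show ?thesis
    using inj by (simp add: vec.dim_eq_card_independent rows card_image)
qed

lemma associated_code_exists:
  fixes M :: "('a::{field,finite}, 'k::finite) point_multiset"
  assumes span: "spanning M" and m: "CARD('m::finite) = (\<Sum>P\<in>proj_points. M P)"
  shows "\<exists>D :: ('a ^ 'm) set. associated_code M D"
proof -
  have fin: "finite (proj_points :: ('a ^ 'k) set set)" by simp
  define S where "S = (SIGMA P:(proj_points :: ('a ^ 'k) set set). {..<M P})"
  have "card S = CARD('m)"
    unfolding S_def by (subst card_SigmaI) (auto simp: m fin)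
  moreover have "finite S"
    unfolding S_def using fin by (intro finite_SigmaI) auto
  ultimately obtain f :: "'m \<Rightarrow> ('a ^ 'k) set \<times> nat" where f: "bij_betw f UNIV S"
    using finite_same_card_bij[of "UNIV :: 'm set" S] by auto
  obtain v where v: "\<And>P. P \<in> proj_points \<Longrightarrow> v P \<noteq> 0 \<and> vec.span {v P} = (P :: ('a ^ 'k) set)"
    using proj_point_span by metis
  define H :: "'a ^ 'm ^ 'k" where "H = (\<chi> i j. v (fst (f j)) $ i)"
  have col: "column j H = v (fst (f j))" for j
    by (simp add: H_def column_def vec_eq_iff)
  have fS: "f j \<in> S" for j
    using bij_betwE[OF f] by blast
  have pt: "fst (f j) \<in> proj_points" for j
    using fS[of j] by (auto simp: S_def)
  have mult: "column_multiset H P = M P" if P: "P \<in> proj_points" for P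
  proof -
    have "{j. vec.span {column j H} = P} = {j. fst (f j) = P}"
      using v pt by (simp add: col)
    moreover have "f ` {j. fst (f j) = P} = Pair P ` {..<M P}" (is "?L = ?R")
    proof
      show "?L \<subseteq> ?R"
      proof
        fix x assume "x \<in> ?L"
        then obtain j where "x = f j" "fst (f j) = P" by blast
        then show "x \<in> ?R" using fS[of j] by (cases "f j") (auto simp: S_def)
      qed
      show "?R \<subseteq> ?L"
      proof
        fix x assume x: "x \<in> ?R"
        then have "x \<in> S" using P by (auto simp: S_def)
        then obtain j where j: "x = f j" using f by (auto simp: bij_betw_def)
        moreover have "fst (f j) = P" using x unfolding j by auto
        ultimately show "x \<in> ?L" by blast
      qed
    qed
    moreover have "inj_on f {j. fst (f j) = P}"
      using f by (meson bij_betw_def inj_on_subset subset_UNIV)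
    moreover have "card (Pair P ` {..<M P}) = M P"
      by (simp add: card_image inj_on_def)
    ultimately show ?thesis
      unfolding column_multiset_def by (metis card_image)
  qed
  have "P \<subseteq> vec.span (columns H)" if P: "P \<in> proj_points" "M P > 0" for P
  proof -
    have "{j. vec.span {column j H} = P} \<noteq> {}"
      using mult[OF P(1)] P(2) by (metis card.empty column_multiset_def less_irrefl)
    then obtain j where "vec.span {column j H} = P" by blast
    then show ?thesis
      using vec.span_mono[of "{column j H}" "columns H"] by (auto simp: columns_def)
  qed
  then have "vec.span (\<Union>{P \<in> proj_points. M P > 0}) \<subseteq> vec.span (columns H)"
    by (intro vec.span_minimal) auto
  then have "vec.span (columns H) = UNIV"
    using span by (auto simp: spanning_def)
  then have dim: "vec.dim (vec.span (rows H)) = CARD('k)"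
    using dim_rows_if_columns_span by simp
  have "j \<in> supp (vec.span (rows H))" for j
  proof -
    have "column j H \<noteq> 0" using v pt by (simp add: col)
    then obtain i where "H $ i $ j \<noteq> 0" by (auto simp: column_def vec_eq_iff)
    moreover have "row i H \<in> vec.span (rows H)"
      by (rule vec.span_base) (auto simp: rows_def)
    ultimately show ?thesis by (auto simp: supp_def row_def)
  qed
  then have "supp (vec.span (rows H)) = UNIV" by blast
  then have "associated_code M (vec.span (rows H))"
    using dim mult
    by (auto simp: associated_code_def full_length_def weight_def generator_matrix_def
        linear_code_def intro!: exI[of _ H])
  then show ?thesis by blast
qed

end

(* Subspaces U of the message space correspond to subcodes of C and of D under encoding. A
   coordinate of the encoded U vanishes iff the corresponding column lies in the annihilator of U,
   so the weight is the number of points outside the annihilator, counted with multiplicity. A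
   multiset and its complement together count each such point l times, and the number of these
   points depends only on dim U; hence the two weights of U have a constant sum. *)

theory Submission
  imports Defs
begin

section \<open>Annihilators for the standard bilinear form\<close>

definition annihilator :: "('a::field ^ 'k) set \<Rightarrow> ('a ^ 'k) set" where
  "annihilator U = {v. \<forall>u\<in>U. (\<Sum>i\<in>UNIV. u $ i * v $ i) = 0}"

lemma subspace_annihilator: "vec.subspace (annihilator U)"
  by (rule vec.subspaceI)
    (simp_all add: annihilator_def distrib_left sum.distrib mult.left_commute flip: sum_distrib_left)

text \<open>The form is linear in \<open>u\<close>, so orthogonality to generators suffices.
  Membership in the annihilator of a subspace can thus be tested on a basis.\<close>

lemma annihilator_span: "annihilator (vec.span B) = annihilator B"
proof
  show "annihilator (vec.span B) \<subseteq> annihilator B"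
    using vec.span_base by (auto simp: annihilator_def)
  show "annihilator B \<subseteq> annihilator (vec.span B)"
  proof
    fix v assume v: "v \<in> annihilator B"
    have "(\<Sum>i\<in>UNIV. u $ i * v $ i) = 0" if "u \<in> vec.span B" for u
      using that
    proof (induction rule: vec.span_induct_alt)
      case base
      show ?case by simp
    next
      case (step c x y)
      have "(\<Sum>i\<in>UNIV. (c *s x + y) $ i * v $ i) =
          c * (\<Sum>i\<in>UNIV. x $ i * v $ i) + (\<Sum>i\<in>UNIV. y $ i * v $ i)"
        by (simp add: distrib_right sum.distrib sum_distrib_left mult.assoc)
      then show ?case using step v by (simp add: annihilator_def)
    qed
    then show "v \<in> annihilator (vec.span B)" by (simp add: annihilator_def)
  qed
qed

text \<open>The set is a product over the coordinates: a singleton factor on \<open>I\<close>, the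
  whole field off \<open>I\<close>.\<close>

lemma card_vanishing_coordinates:
  fixes I :: "'k::finite set"
  shows "card {w :: 'a::{zero,finite} ^ 'k. \<forall>i\<in>I. w $ i = 0} = CARD('a) ^ (CARD('k) - card I)"
proof -
  have "bij_betw vec_nth {w :: 'a ^ 'k. \<forall>i\<in>I. w $ i = 0}
      (PiE UNIV (\<lambda>i. if i \<in> I then {0} else UNIV))"
    by (rule bij_betw_byWitness[where f' = vec_lambda])
      (auto simp: PiE_iff split: if_splits)
  then have "card {w :: 'a ^ 'k. \<forall>i\<in>I. w $ i = 0} =
      (\<Prod>i\<in>UNIV. card (if i \<in> I then {0} else UNIV :: 'a set))"
    by (simp add: bij_betw_same_card card_PiE)
  also have "\<dots> = (\<Prod>i\<in>- I. CARD('a))"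
    by (rule prod.mono_neutral_cong_right) auto
  finally show ?thesis by (simp add: Compl_eq_Diff_UNIV card_Diff_subset)
qed

(* A basis of U extended to a basis of the whole space gives the rows of an invertible matrix,
   which maps the annihilator to the vectors vanishing on dim U coordinates. *)
lemma card_annihilator:
  fixes U :: "('a::{field,finite} ^ 'k) set"
  assumes U: "vec.subspace U"
  shows "card (annihilator U) = CARD('a) ^ (CARD('k) - vec.dim U)"
proof -
  obtain B where B: "B \<subseteq> U" "vec.independent B" "U \<subseteq> vec.span B" "card B = vec.dim U"
    using vec.basis_exists[of U] by blast
  have UB: "U = vec.span B"
    using B U vec.span_minimal by blast
  define E where "E = vec.extend_basis B"
  have E: "B \<subseteq> E" "vec.independent E" "vec.span E = UNIV"
    using B(2) by (simp_all add: E_def vec.extend_basis_superset vec.independent_extend_basis)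
  have "card E = vec.dim (UNIV :: ('a ^ 'k) set)"
    using E by (metis vec.dim_eq_card vec.span_UNIV)
  then have "card E = CARD('k)" by (simp only: vec_dim_card)
  then obtain f where f: "bij_betw f (UNIV :: 'k set) E"
    using finite_same_card_bij[of "UNIV :: 'k set" E] by auto
  define A :: "'a ^ 'k ^ 'k" where "A = (\<chi> i. f i)"
  have A: "(A *v v) $ i = (\<Sum>j\<in>UNIV. f i $ j * v $ j)" for v i
    by (simp add: A_def matrix_vector_mult_def)
  have "rows A = E"
    using f by (auto simp: rows_def row_def A_def bij_betw_def image_def vec_lambda_eta)
  then obtain A' where "A' ** A = mat 1"
    using E(3) matrix_left_invertible_span_rows_gen by blast
  then have "inj ((*v) A)"
    by (metis matrix_left_invertible_injective)
  \<comment> \<open>On a finite space injectivity already gives surjectivity, so preimages under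
    \<open>A\<close> keep their cardinality.\<close>
  then have bij: "bij ((*v) A)"
    by (simp add: bij_def finite_UNIV_inj_surj)
  define I where "I = f -` B"
  have fI: "f ` I = B"
    using f E(1) by (auto simp: I_def bij_betw_def)
  have "card I = vec.dim U"
    using f B(4) fI by (metis bij_betw_def card_image inj_on_subset subset_UNIV)
  have "v \<in> annihilator U \<longleftrightarrow> (\<forall>i\<in>I. (A *v v) $ i = 0)" for v
    unfolding UB annihilator_span fI[symmetric] by (simp add: annihilator_def A)
  then have "annihilator U = (*v) A -` {w. \<forall>i\<in>I. w $ i = 0}" by auto
  then have "card (annihilator U) = card {w :: 'a ^ 'k. \<forall>i\<in>I. w $ i = 0}"
    using bij by (simp only: bij_def card_vimage_inj subset_UNIV)
  then show ?thesis
    by (simp add: card_vanishing_coordinates \<open>card I = vec.dim U\<close>)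
qed

section \<open>Projective points and the number of them outside a subspace\<close>

lemma span_singleton_proj_point:
  fixes v :: "'a::field ^ 'k"
  assumes "v \<noteq> 0"
  shows "vec.span {v} \<in> proj_points"
  using assms by (simp add: proj_points_def vec.dim_eq_card_independent)

text \<open>Since any nonzero vector determines its point, distinct points meet only in 0. This
  gives the disjointness used in counting.\<close>

lemma proj_point_eq_span:
  fixes P :: "('a::field ^ 'k) set"
  assumes "P \<in> proj_points" "v \<in> P" "v \<noteq> 0"
  shows "vec.span {v} = P"
proof (rule vec.subspace_dim_equal)
  show "vec.span {v} \<subseteq> P"
    using assms by (intro vec.span_minimal) (auto simp: proj_points_def)
  show "vec.dim P \<le> vec.dim (vec.span {v})"
    using assms span_singleton_proj_point[of v] by (simp add: proj_points_def)
qed (use assms in \<open>auto simp: proj_points_def\<close>)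

lemma card_proj_point:
  fixes P :: "('a::{field,finite} ^ 'k) set"
  assumes "P \<in> proj_points"
  shows "card (P - {0}) = CARD('a) - 1"
proof -
  obtain v where v: "v \<noteq> 0" "vec.span {v} = P"
    using proj_point_span[OF assms] by blast
  have "P = range (\<lambda>c. c *s v)"
    using v(2) vec.span_singleton by blast
  moreover have "inj (\<lambda>c. c *s v)"
    using v(1) by (simp add: inj_on_def)
  ultimately have "card P = CARD('a)"
    by (simp add: card_image)
  moreover have "0 \<in> P"
    using assms by (simp add: proj_points_def vec.subspace_0)
  ultimately show ?thesis by simp
qed

definition points_outside :: "('a::field ^ 'k) set \<Rightarrow> ('a ^ 'k) set set" where
  "points_outside W = {P \<in> proj_points. \<not> P \<subseteq> W}"

text \<open>The case \<open>v = 0\<close> is included: its span has dimension 0 and is no point,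
  while 0 lies in \<open>W\<close>. Zero columns of a matrix therefore need no separate
  treatment.\<close>

lemma span_in_points_outside:
  fixes W :: "('a::field ^ 'k) set"
  assumes W: "vec.subspace W"
  shows "vec.span {v} \<in> points_outside W \<longleftrightarrow> v \<notin> W"
proof (cases "v = 0")
  case True
  then show ?thesis
    using W by (simp add: points_outside_def proj_points_def vec.subspace_0)
next
  case False
  have "vec.span {v} \<subseteq> W \<longleftrightarrow> v \<in> W"
    using W vec.span_base vec.span_minimal[of "{v}" W] by blast
  then show ?thesis
    using False by (simp add: points_outside_def span_singleton_proj_point)
qed

text \<open>With 0 removed, the points outside \<open>W\<close> partition the complement of
  \<open>W\<close> into blocks of \<open>q - 1\<close> vectors, where \<open>q\<close> is the field
  size.\<close>

lemma card_points_outside: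
  fixes W :: "('a::{field,finite} ^ 'k) set"
  assumes W: "vec.subspace W"
  shows "card (points_outside W) * (CARD('a) - 1) = CARD('a) ^ CARD('k) - card W"
proof -
  have pp: "P \<in> proj_points" if "P \<in> points_outside W" for P
    using that by (simp add: points_outside_def)
  have "- W = (\<Union>P\<in>points_outside W. P - {0})"
  proof (intro equalityI subsetI)
    fix v assume "v \<in> - W"
    then show "v \<in> (\<Union>P\<in>points_outside W. P - {0})"
      using W span_in_points_outside[OF W, of v] vec.span_base[of v "{v}"]
      by (auto simp: vec.subspace_0)
  next
    \<comment> \<open>A point not contained in \<open>W\<close> meets it only in 0, because each of
      its nonzero vectors spans it.\<close>
    fix v assume "v \<in> (\<Union>P\<in>points_outside W. P - {0})"
    then obtain P where P: "P \<in> points_outside W" "v \<in> P" "v \<noteq> 0" by blast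
    then have "vec.span {v} = P" using pp proj_point_eq_span by blast
    then show "v \<in> - W" using P(1) span_in_points_outside[OF W, of v] by simp
  qed
  moreover have "card (\<Union>P\<in>points_outside W. P - {0}) = (\<Sum>P\<in>points_outside W. card (P - {0}))"
  proof (rule card_UN_disjoint)
    show "\<forall>P\<in>points_outside W. \<forall>Q\<in>points_outside W. P \<noteq> Q \<longrightarrow> (P - {0}) \<inter> (Q - {0}) = {}"
      using pp proj_point_eq_span by blast
  qed simp_all
  moreover have "\<dots> = card (points_outside W) * (CARD('a) - 1)"
    using pp by (simp add: card_proj_point)
  ultimately show ?thesis
    by (metis CARD_vec Compl_eq_Diff_UNIV card_Diff_subset finite subset_UNIV)
qed

text \<open>The \<open>div\<close> in \<open>gauss_number\<close> is exact because
  \<open>q - 1\<close> divides \<open>q ^ r - 1\<close>; for \<open>q = 1\<close> both sides are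
  0.\<close>

lemma gauss_number_mult:
  assumes "q \<ge> 1"
  shows "gauss_number q r * (q - 1) = q ^ r - 1"
proof -
  have "int q - 1 dvd int q ^ r - 1"
    by (metis dvd_triv_left power_diff_1_eq)
  then have "q - 1 dvd q ^ r - 1"
    using assms by (simp add: of_nat_diff flip: int_dvd_int_iff)
  then show ?thesis by (simp add: gauss_number_def)
qed

lemma card_points_outside_annihilator:
  fixes U :: "('a::{field,finite} ^ 'k) set"
  assumes U: "vec.subspace U" "vec.dim U = r"
  shows "card (points_outside (annihilator U)) = CARD('a) ^ (CARD('k) - r) * gauss_number CARD('a) r"
proof -
  let ?q = "CARD('a)" and ?k = "CARD('k)"
  \<comment> \<open>This makes \<open>?q - 1\<close> positive, so that it can be cancelled at the
    end.\<close>
  have "card {0, 1 :: 'a} \<le> ?q" by (rule card_mono) simp_all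
  then have q: "?q \<ge> 2" by simp
  have "r \<le> ?k"
    using vec.dim_subset[of U UNIV] unfolding U(2) vec_dim_card by simp
  then have "?q ^ ?k = ?q ^ (?k - r) * ?q ^ r"
    by (simp flip: power_add)
  then have "card (points_outside (annihilator U)) * (?q - 1) = ?q ^ (?k - r) * (?q ^ r - 1)"
    using card_points_outside[OF subspace_annihilator, of U] card_annihilator[OF U(1)] U(2)
    by (simp add: diff_mult_distrib2)
  also have "\<dots> = ?q ^ (?k - r) * gauss_number ?q r * (?q - 1)"
    using gauss_number_mult[of ?q r] q by (simp add: mult.assoc)
  finally show ?thesis using q by simp
qed

section \<open>Encoding, and subcodes as images of message subspaces\<close>

definition encode :: "'a::field ^ 'n ^ 'k \<Rightarrow> 'a ^ 'k \<Rightarrow> 'a ^ 'n" where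
  "encode G x = x v* G"

lemma linear_encode: "Vector_Spaces.linear (*s) (*s) (encode G)"
proof -
  have "encode G = (*v) (transpose G)"
    by (simp add: encode_def fun_eq_iff)
  then show ?thesis by (simp only: matrix_vector_mul_linear_gen)
qed

lemma encode_nth: "encode G x $ j = (\<Sum>i\<in>UNIV. x $ i * column j G $ i)"
  by (simp add: encode_def vector_matrix_mult_def column_def mult.commute)

lemma supp_encode:
  "supp (encode G ` U) = {j. column j G \<notin> annihilator U}"
  by (auto simp: supp_def encode_nth annihilator_def)

text \<open>A coordinate is in the support iff its column spans a point outside the annihilator; the
  sum groups these coordinates by that point.\<close>

lemma weight_encode:
  fixes G :: "'a::{field,finite} ^ 'n ^ 'k"
  shows "weight (encode G ` U) = (\<Sum>P\<in>points_outside (annihilator U). column_multiset G P)"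
proof -
  have "supp (encode G ` U) =
      (\<Union>P\<in>points_outside (annihilator U). {j. vec.span {column j G} = P})"
    using span_in_points_outside[OF subspace_annihilator] by (auto simp: supp_encode)
  then show ?thesis
    unfolding weight_def column_multiset_def by (simp add: card_UN_disjoint disjoint_iff)
qed

context
  fixes G :: "'a::{field,finite} ^ 'n ^ 'k" and C
  assumes G: "generator_matrix G C"
begin

text \<open>Unit vectors encode to the rows of \<open>G\<close>, so by linearity the whole space
  encodes to the row span.\<close>

lemma range_encode: "range (encode G) = C"
proof -
  have "encode G (axis i 1) $ j = row i G $ j" for i j
  proof -
    have "encode G (axis i 1) $ j = (\<Sum>i'\<in>UNIV. if i' = i then G $ i' $ j else 0)"
      unfolding encode_nth by (rule sum.cong) (auto simp: axis_def column_def)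
    then show ?thesis by (simp add: row_def)
  qed
  then have "encode G (axis i 1) = row i G" for i
    by (simp add: vec_eq_iff)
  then have "rows G = encode G ` range (\<lambda>i. axis i 1)"
    by (simp add: rows_def image_image full_SetCompr_eq)
  moreover have "vec.span (range (\<lambda>i. axis i 1)) = (UNIV :: ('a ^ 'k) set)"
    using span_cart_basis by (simp add: cart_basis_def full_SetCompr_eq)
  ultimately show ?thesis
    using G vec.linear_span_image[OF linear_encode] unfolding generator_matrix_def by metis
qed

text \<open>\<open>C\<close> has the dimension, hence the cardinality, of the message space, and a
  surjection between finite sets of equal size is injective.\<close>

lemma inj_encode: "inj (encode G)"
proof -
  have C: "vec.subspace C" "vec.dim C = CARD('k)"
    using G by (auto simp: generator_matrix_def linear_code_def)
  obtain h :: "'a ^ 'k \<Rightarrow> 'a ^ 'n" where "h ` UNIV = C" "inj h"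
    using vec.subspace_isomorphism[OF vec.subspace_UNIV C(1)] unfolding C(2) vec_dim_card by blast
  then have "card C = CARD('a ^ 'k)" using card_image by blast
  then show ?thesis
    using range_encode by (intro eq_card_imp_inj_on) auto
qed

lemma bij_betw_subspaces_subcodes:
  "bij_betw (image (encode G)) {U. vec.subspace U \<and> vec.dim U = r} (subcodes r C)"
proof -
  interpret e: Vector_Spaces.linear "(*s)" "(*s)" "encode G" by (rule linear_encode)
  have dim: "vec.dim (encode G ` U) = vec.dim U" for U
    using inj_encode by (intro vec.dim_image_eq linear_encode) (auto intro: inj_on_subset)
  have "A \<in> image (encode G) ` {U. vec.subspace U \<and> vec.dim U = r}" if "A \<in> subcodes r C" for A
  proof -
    have A: "A \<subseteq> C" "vec.subspace A" "vec.dim A = r"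
      using that by (auto simp: subcodes_def linear_code_def)
    have "A = encode G ` (encode G -` A)" using A(1) range_encode by auto
    moreover have "vec.subspace (encode G -` A)" using A(2) by (rule e.subspace_vimage)
    moreover have "vec.dim (encode G -` A) = r" using calculation(1) A(3) dim by metis
    ultimately show ?thesis by blast
  qed
  moreover have "encode G ` U \<in> subcodes r C" if "vec.subspace U" "vec.dim U = r" for U
    using that e.subspace_image range_encode by (auto simp: subcodes_def linear_code_def dim)
  ultimately show ?thesis
    using inj_encode by (auto simp: bij_betw_def inj_on_def inj_image_eq_iff)
qed

text \<open>Moves the count to the message space, where codes of different lengths are compared over
  the same subspaces.\<close>

lemma weight_count_encode:
  "weight_count r j C =
    card {U. vec.subspace U \<and> vec.dim U = r \<and> int (weight (encode G ` U)) = j}"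
proof -
  let ?S = "{U. vec.subspace U \<and> vec.dim U = r}"
  have "subcodes r C = image (encode G) ` ?S"
    using bij_betw_subspaces_subcodes[of r] by (simp add: bij_betw_def)
  then have "{A \<in> subcodes r C. int (weight A) = j} =
      image (encode G) ` {U \<in> ?S. int (weight (encode G ` U)) = j}"
    by auto
  moreover have "inj_on (image (encode G)) {U \<in> ?S. int (weight (encode G ` U)) = j}"
    using bij_betw_subspaces_subcodes[of r] by (auto simp: bij_betw_def intro: inj_on_subset)
  ultimately show ?thesis
    unfolding weight_count_def by (simp add: card_image)
qed

lemma weights_encode:
  "weight ` subcodes r C = (\<lambda>U. weight (encode G ` U)) ` {U. vec.subspace U \<and> vec.dim U = r}"
  using bij_betw_subspaces_subcodes[of r] unfolding bij_betw_def by (metis image_image)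

end

section \<open>Weights for a multiset and its complement\<close>

lemma weight_complement:
  fixes G :: "'a::{field,finite} ^ 'n ^ 'k" and H :: "'a ^ 'm ^ 'k"
  assumes H: "\<forall>P\<in>proj_points. column_multiset H P = complement l (column_multiset G) P"
    and l: "l \<ge> max_multiplicity (column_multiset G)"
    and U: "vec.subspace U" "vec.dim U = r"
  shows "weight (encode H ` U) + weight (encode G ` U) =
    l * CARD('a) ^ (CARD('k) - r) * gauss_number CARD('a) r"
proof -
  \<comment> \<open>This bound keeps the natural subtraction in \<open>complement\<close> from
    truncating, so the two multiplicities add up to \<open>l\<close>.\<close>
  have "column_multiset G P \<le> l" if "P \<in> proj_points" for P
  proof -
    have "column_multiset G P \<le> max_multiplicity (column_multiset G)"
      using that unfolding max_multiplicity_def by (intro Max_ge) simp_all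
    then show ?thesis using l by simp
  qed
  then have "column_multiset H P + column_multiset G P = l" if "P \<in> points_outside (annihilator U)" for P
    using H that by (auto simp: points_outside_def complement_def)
  then have "weight (encode H ` U) + weight (encode G ` U) = (\<Sum>P\<in>points_outside (annihilator U). l)"
    unfolding weight_encode sum.distrib[symmetric] by (rule sum.cong[OF refl])
  then show ?thesis
    by (simp add: card_points_outside_annihilator[OF U] ac_simps)
qed

text \<open>Evaluating the sum at a maximiser of \<open>g\<close> gives one inequality, at a
  minimiser of \<open>f\<close> the other.\<close>

lemma Min_plus_Max_of_constant_sum:
  fixes f g :: "'b \<Rightarrow> nat"
  assumes S: "finite S" "S \<noteq> {}" and c: "\<And>x. x \<in> S \<Longrightarrow> f x + g x = c"
  shows "Min (f ` S) + Max (g ` S) = c"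
proof (rule antisym)
  have "Max (g ` S) \<in> g ` S" "Min (f ` S) \<in> f ` S" using S by simp_all
  then obtain x y where x: "x \<in> S" "Max (g ` S) = g x" and y: "y \<in> S" "Min (f ` S) = f y"
    by blast
  have "Min (f ` S) \<le> f x" "g y \<le> Max (g ` S)" using S x(1) y(1) by simp_all
  then show "Min (f ` S) + Max (g ` S) \<le> c" "c \<le> Min (f ` S) + Max (g ` S)"
    using c[OF x(1)] c[OF y(1)] x(2) y(2) by linarith+
qed

theorem theorem4p1:
  fixes C :: "('a::{field,finite} ^ 'n) set"
    and G :: "'a ^ 'n ^ 'k"
    and D :: "('a ^ 'm) set"
    and q n k l :: nat
  assumes q: "q = CARD('a)" and n: "n = CARD('n)" and k: "k = CARD('k)"
    and code: "linear_code k C" "full_length C"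
    and G: "generator_matrix G C"
    and l: "l \<ge> max_multiplicity (column_multiset G)"
    and span: "spanning (complement l (column_multiset G))"
    and D: "associated_code (complement l (column_multiset G)) D"
  shows "int (effective_length D) = int (l * gauss_number q k) - int n \<and>
    (\<forall>r j. 1 \<le> r \<and> r \<le> k \<longrightarrow>
      weight_count r j D
        = weight_count r (int (l * q ^ (k - r) * gauss_number q r) - j) C) \<and>
    (\<forall>r. 1 \<le> r \<and> r \<le> k \<longrightarrow>
      int (min_weight r D)
        = int (l * q ^ (k - r) * gauss_number q r) - int (max_weight r C) \<and>
      int (max_weight r D)
        = int (l * q ^ (k - r) * gauss_number q r) - int (min_weight r C))"
proof -
  obtain H :: "'a ^ 'm ^ 'k" where H: "generator_matrix H D"
    "\<forall>P\<in>proj_points. column_multiset H P = complement l (column_multiset G) P"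
    using D by (auto simp: associated_code_def)
  define N where "N r = l * q ^ (k - r) * gauss_number q r" for r
  have sum: "weight (encode H ` U) + weight (encode G ` U) = N r"
    if "vec.subspace U" "vec.dim U = r" for U r
    using weight_complement[OF H(2) l that] by (simp add: N_def q k)
  \<comment> \<open>For \<open>U = UNIV\<close> the encoded subspaces are \<open>D\<close> and
    \<open>C\<close> themselves.\<close>
  have "weight D + weight C = N k"
    using sum[of UNIV k] range_encode[OF H(1)] range_encode[OF G]
    by (simp add: vec.subspace_UNIV card_cart_basis k)
  then have "weight D + n = l * gauss_number q k"
    using code(2) n by (simp add: N_def full_length_def)
  then have "int (weight D) = int (l * gauss_number q k) - int n"
    by linarith
  moreover have "weight_count r j D = weight_count r (int (N r) - j) C" for r j
  proof -
    have "int (weight (encode H ` U)) = j \<longleftrightarrow> int (weight (encode G ` U)) = int (N r) - j"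
      if "vec.subspace U" "vec.dim U = r" for U
      using sum[OF that] by linarith
    then show ?thesis
      unfolding weight_count_encode[OF H(1)] weight_count_encode[OF G]
      by (intro arg_cong[where f = card]) blast
  qed
  moreover have "int (min_weight r D) = int (N r) - int (max_weight r C) \<and>
      int (max_weight r D) = int (N r) - int (min_weight r C)" if "r \<le> k" for r
  proof -
    let ?S = "{U :: ('a ^ 'k) set. vec.subspace U \<and> vec.dim U = r}"
    \<comment> \<open>\<open>Min\<close> and \<open>Max\<close> are only meaningful on nonempty
      sets; \<open>r \<le> k\<close> supplies a subspace of dimension \<open>r\<close>.\<close>
    have ne: "?S \<noteq> {}"
      using vec.choose_subspace_of_subspace[of r "UNIV :: ('a ^ 'k) set"] that k
      by (auto simp: card_cart_basis)
    \<comment> \<open>The second equation is the first with the two codes exchanged, as the constant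
      sum is symmetric in them.\<close>
    have "min_weight r D + max_weight r C = N r" "min_weight r C + max_weight r D = N r"
      unfolding min_weight_def max_weight_def weights_encode[OF H(1)] weights_encode[OF G]
      by (rule Min_plus_Max_of_constant_sum[OF _ ne]; use sum in \<open>force simp: add.commute\<close>)+
    then show ?thesis by linarith
  qed
  ultimately show ?thesis unfolding N_def by blast
qed

end
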